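(* Let $G=(V,E)$ be a nonempty finite graph in which every vertex carries a loop, and let $H$ be a graph on the same vertex set obtained from $G$ by deleting $l$ non-loop edges and adding $m$ non-loop edges (loops kept). Then $$-4l-2m\le \gamma(G)-\gamma(H)\le 2l+4m.$$
   Context: All graphs are finite with vertex set $V$, $|V|=n$, and every vertex has a loop. For $v\in V$, the neighborhood $N_v=\{w\in V:(v,w)\in E\}$ contains $v$ itself. An opinion function is a map $f:V\to\{-1,1\}$, extended to subsets by $f(W)=\sum_{w\in W}f(w)$. $V^+=\{v\in V: f(N_v)>0\}$. The opinion function $f$ is strictly majoritarian on the graph if $|V^+|>|V|/2$. The strict domination number is $\gamma(G)=\min\{f(V): f \text{ strictly majoritarian on } G\}$. *)

theory Defs
  imports "Graph_Theory.Pair_Digraph" "HOL-Library.FuncSet"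
begin

(* An undirected graph is a symmetric set of ordered pairs, as in the parent library;
   pair_pseudo_graph is finite and symmetric, and (unlike pair_graph) permits loops. *)
locale looped_graph = pair_pseudo_graph +
  assumes loops: "\<And>v. v \<in> pverts G \<Longrightarrow> (v, v) \<in> parcs G"

(* Each non-loop undirected edge, i.e. each pair of opposite arcs, is counted once. *)
definition nonloop_edges :: "'a pair_pre_digraph \<Rightarrow> 'a set set" where
  "nonloop_edges G = {{u, v} | u v. (u, v) \<in> parcs G \<and> u \<noteq> v}"

definition neighborhood :: "'a pair_pre_digraph \<Rightarrow> 'a \<Rightarrow> 'a set" where
  "neighborhood G v = {w \<in> pverts G. (v, w) \<in> parcs G}"

definition opinion_functions :: "'a pair_pre_digraph \<Rightarrow> ('a \<Rightarrow> int) set" where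
  "opinion_functions G = pverts G \<rightarrow>\<^sub>E {-1, 1}"

definition positive_vertices :: "'a pair_pre_digraph \<Rightarrow> ('a \<Rightarrow> int) \<Rightarrow> 'a set" where
  "positive_vertices G f = {v \<in> pverts G. sum f (neighborhood G v) > 0}"

definition strictly_majoritarian :: "'a pair_pre_digraph \<Rightarrow> ('a \<Rightarrow> int) \<Rightarrow> bool" where
  "strictly_majoritarian G f \<longleftrightarrow>
     real (card (positive_vertices G f)) > real (card (pverts G)) / 2"

definition strict_domination_number :: "'a pair_pre_digraph \<Rightarrow> int" where
  "strict_domination_number G =
     Min {sum f (pverts G) | f. f \<in> opinion_functions G \<and> strictly_majoritarian G f}"

(* The minimum is over a finite set, nonempty as soon as the graph has a vertex. *)
lemma (in looped_graph) strict_domination_number_attained: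
  assumes "pverts G \<noteq> {}"
  shows "finite {sum f (pverts G) | f. f \<in> opinion_functions G \<and> strictly_majoritarian G f}"
    and "{sum f (pverts G) | f. f \<in> opinion_functions G \<and> strictly_majoritarian G f} \<noteq> {}"
proof -
  have fin: "finite (opinion_functions G)"
    unfolding opinion_functions_def by (intro finite_PiE pair_finite_verts) auto
  show "finite {sum f (pverts G) | f. f \<in> opinion_functions G \<and> strictly_majoritarian G f}"
    by (rule finite_subset[OF _ finite_imageI[OF fin, of "\<lambda>f. sum f (pverts G)"]]) auto
  let ?f = "restrict (\<lambda>_. 1 :: int) (pverts G)"
  have "sum ?f (neighborhood G v) > 0" if "v \<in> pverts G" for v
  proof -
    have "finite (neighborhood G v)" "v \<in> neighborhood G v"
      using that loops[OF that] pair_finite_verts by (auto simp: neighborhood_def)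
    then have "card (neighborhood G v) > 0"
      by (auto simp: card_gt_0_iff)
    moreover have "sum ?f (neighborhood G v) = (\<Sum>w\<in>neighborhood G v. 1)"
      by (rule sum.cong) (auto simp: neighborhood_def)
    ultimately show ?thesis by simp
  qed
  then have "positive_vertices G ?f = pverts G"
    by (auto simp: positive_vertices_def)
  moreover have "card (pverts G) > 0"
    using assms pair_finite_verts by (simp add: card_gt_0_iff)
  ultimately have "strictly_majoritarian G ?f"
    by (simp add: strictly_majoritarian_def)
  moreover have "?f \<in> opinion_functions G"
    by (auto simp: opinion_functions_def)
  ultimately show
    "{sum f (pverts G) | f. f \<in> opinion_functions G \<and> strictly_majoritarian G f} \<noteq> {}"
    by blast
qed

(* Deletions are carried out first; A may then be any set of edges absent from what
   remains, in particular any set of non-edges of G.  Finiteness of D and A, and that A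
   consists of 2-element subsets of the vertex set, follow when G and H are looped graphs. *)
definition edge_edit ::
    "nat \<Rightarrow> nat \<Rightarrow> 'a pair_pre_digraph \<Rightarrow> 'a pair_pre_digraph \<Rightarrow> bool" where
  "edge_edit l m G H \<longleftrightarrow> pverts H = pverts G \<and>
     (\<exists>D A. D \<subseteq> nonloop_edges G \<and> card D = l \<and>
            A \<inter> (nonloop_edges G - D) = {} \<and> card A = m \<and>
            nonloop_edges H = (nonloop_edges G - D) \<union> A)"

end

theory Submission
  imports Defs
begin

text \<open>
  It suffices to treat a single edge \<open>uv\<close>, and to start from an optimal opinion function.
  When \<open>uv\<close> is added, turning one endpoint of opinion \<open>-1\<close> (if there is one) into \<open>1\<close> costs
  at most 2 and keeps both neighborhood sums positive.
  When \<open>uv\<close> is deleted, a positive neighborhood sum at an endpoint drops at worst to \<open>0\<close>;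
  then, because of the loop, the neighborhood contains an opinion \<open>-1\<close>, and turning it into
  \<open>1\<close> restores positivity. Doing this at both endpoints costs at most 4.

  Since loops are fixed, a looped graph is determined by its vertex set and its non-loop edges,
  and the edit steps are carried out on this representation.
\<close>

section \<open>Looped graphs as vertex and edge sets\<close>

text \<open>The disjunct \<open>w = v\<close> stands for the loop, since \<open>E\<close> is meant
  to hold non-loop edges only.\<close>

definition nbhd :: "'a set \<Rightarrow> 'a set set \<Rightarrow> 'a \<Rightarrow> 'a set" where
  "nbhd V E v = {w \<in> V. w = v \<or> {v, w} \<in> E}"

text \<open>Doubling the count expresses the strict majority over the naturals, without halving in
  the reals.\<close>

definition majority_functions :: "'a set \<Rightarrow> 'a set set \<Rightarrow> ('a \<Rightarrow> int) set" where
  "majority_functions V E =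
     {f \<in> V \<rightarrow>\<^sub>E {-1, 1}. card V < 2 * card {v \<in> V. sum f (nbhd V E v) > 0}}"

definition domination :: "'a set \<Rightarrow> 'a set set \<Rightarrow> int" where
  "domination V E = Min ((\<lambda>f. sum f V) ` majority_functions V E)"

lemma (in looped_graph) neighborhood_eq_nbhd:
  assumes "v \<in> pverts G"
  shows "neighborhood G v = nbhd (pverts G) (nonloop_edges G) v"
proof -
  have "sym (parcs G)"
    using arcs_symmetric by (auto intro: symI)
  then show ?thesis
    using loops[OF assms]
    by (auto simp: neighborhood_def nbhd_def nonloop_edges_def doubleton_eq_iff dest: symD)
qed

lemma (in looped_graph) strict_domination_number_eq:
  "strict_domination_number G = domination (pverts G) (nonloop_edges G)"
proof -
  have "positive_vertices G f =
      {v \<in> pverts G. sum f (nbhd (pverts G) (nonloop_edges G) v) > 0}" for f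
    by (auto simp: positive_vertices_def neighborhood_eq_nbhd)
  then have "strictly_majoritarian G f \<longleftrightarrow> card (pverts G) <
      2 * card {v \<in> pverts G. sum f (nbhd (pverts G) (nonloop_edges G) v) > 0}" for f
    by (simp add: strictly_majoritarian_def) linarith
  then have "{sum f (pverts G) | f. f \<in> opinion_functions G \<and> strictly_majoritarian G f} =
      (\<lambda>f. sum f (pverts G)) ` majority_functions (pverts G) (nonloop_edges G)"
    by (auto simp: majority_functions_def opinion_functions_def)
  then show ?thesis
    by (simp add: strict_domination_number_def domination_def)
qed

lemma (in looped_graph) nonloop_edges_obtain:
  assumes "e \<in> nonloop_edges G"
  obtains u v where "e = {u, v}" "u \<noteq> v" "u \<in> pverts G" "v \<in> pverts G"
  using assms in_arcsD1 in_arcsD2 by (auto simp: nonloop_edges_def)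

lemma (in looped_graph) finite_nonloop_edges: "finite (nonloop_edges G)"
proof (rule finite_subset)
  show "nonloop_edges G \<subseteq> Pow (pverts G)"
    by (auto elim: nonloop_edges_obtain)
qed simp

section \<open>Neighborhood sums and attainment of the minimum\<close>

lemma finite_nbhd: "finite V \<Longrightarrow> finite (nbhd V E v)"
  by (simp add: nbhd_def)

lemma self_in_nbhd: "v \<in> V \<Longrightarrow> v \<in> nbhd V E v"
  by (simp add: nbhd_def)

lemma nbhd_insert_other:
  "x \<notin> {u, v} \<Longrightarrow> nbhd V (insert {u, v} E) x = nbhd V E x"
  by (auto simp: nbhd_def doubleton_eq_iff)

lemma sum_nbhd_insert:
  fixes f :: "'a \<Rightarrow> int"
  assumes "finite V" "v \<in> V" "u \<noteq> v" "{u, v} \<notin> E"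
  shows "sum f (nbhd V (insert {u, v} E) u) = f v + sum f (nbhd V E u)"
proof -
  have "nbhd V (insert {u, v} E) u = insert v (nbhd V E u)" "v \<notin> nbhd V E u"
    using assms by (auto simp: nbhd_def doubleton_eq_iff)
  then show ?thesis
    using assms(1) by (simp add: finite_nbhd)
qed

lemma finite_majority_functions: "finite V \<Longrightarrow> finite (majority_functions V E)"
  by (simp add: majority_functions_def finite_PiE)

lemma majority_functions_nonempty:
  assumes "finite V" "V \<noteq> {}"
  shows "majority_functions V E \<noteq> {}"
proof -
  let ?f = "restrict (\<lambda>_. 1 :: int) V"
  have "sum ?f (nbhd V E v) > 0" if "v \<in> V" for v
    using self_in_nbhd[OF that, of E] finite_nbhd[OF assms(1)]
    by (intro sum_pos) (auto simp: nbhd_def)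
  then have "{v \<in> V. sum ?f (nbhd V E v) > 0} = V"
    by blast
  then have "?f \<in> majority_functions V E"
    using assms by (auto simp: majority_functions_def card_gt_0_iff)
  then show ?thesis
    by blast
qed

lemma domination_attained:
  assumes "finite V" "V \<noteq> {}"
  obtains f where "f \<in> majority_functions V E" "domination V E = sum f V"
proof -
  have "domination V E \<in> (\<lambda>f. sum f V) ` majority_functions V E"
    unfolding domination_def using assms
    by (intro Min_in) (simp_all add: finite_majority_functions majority_functions_nonempty)
  then show thesis
    using that by blast
qed

section \<open>Raising opinions to 1\<close>

text \<open>Restricting to \<open>V\<close> keeps the modified function extensional, so that it is
  again an opinion function.\<close>

definition raise :: "'a set \<Rightarrow> 'a set \<Rightarrow> ('a \<Rightarrow> int) \<Rightarrow> 'a \<Rightarrow> int" where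
  "raise V S f = (\<lambda>w\<in>V. if w \<in> S then 1 else f w)"

lemma raise_in: "w \<in> S \<Longrightarrow> w \<in> V \<Longrightarrow> raise V S f w = 1"
  by (simp add: raise_def)

lemma raise_ge: "f \<in> V \<rightarrow>\<^sub>E {-1, 1} \<Longrightarrow> w \<in> V \<Longrightarrow> f w \<le> raise V S f w"
  by (force simp: raise_def dest: PiE_mem)

lemma sum_raise_ge:
  "f \<in> V \<rightarrow>\<^sub>E {-1, 1} \<Longrightarrow> sum f (nbhd V E x) \<le> sum (raise V S f) (nbhd V E x)"
  by (intro sum_mono raise_ge) (auto simp: nbhd_def)

text \<open>The term at \<open>w\<close> goes from -1 to 1 and no other term decreases.\<close>

lemma sum_raise_gain:
  assumes "finite V" "f \<in> V \<rightarrow>\<^sub>E {-1, 1}" "w \<in> nbhd V E x" "w \<in> S" "f w = -1"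
  shows "sum f (nbhd V E x) + 2 \<le> sum (raise V S f) (nbhd V E x)"
proof -
  have "sum f (nbhd V E x - {w}) \<le> sum (raise V S f) (nbhd V E x - {w})"
    using assms(2) by (intro sum_mono raise_ge) (auto simp: nbhd_def)
  moreover have "raise V S f w = 1"
    using assms by (auto simp: nbhd_def intro: raise_in)
  ultimately show ?thesis
    using assms by (simp add: sum.remove[OF finite_nbhd[OF assms(1)] assms(3)])
qed

text \<open>If positive vertices stay positive, the majority survives the change of graph, so the
  raised function competes in the minimum for \<open>E'\<close>. This reduces each edge edit to
  choosing a small \<open>S\<close>.\<close>

lemma domination_le_raise:
  assumes "finite V" "f \<in> majority_functions V E" "S \<subseteq> V"
    and pos: "\<And>x. x \<in> V \<Longrightarrow> sum f (nbhd V E x) > 0 \<Longrightarrow> sum (raise V S f) (nbhd V E' x) > 0"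
  shows "domination V E' \<le> sum f V + 2 * int (card S)"
proof -
  let ?g = "raise V S f"
  have f: "f \<in> V \<rightarrow>\<^sub>E {-1, 1}"
    using assms(2) by (simp add: majority_functions_def)
  have "card {v \<in> V. sum f (nbhd V E v) > 0} \<le> card {v \<in> V. sum ?g (nbhd V E' v) > 0}"
    using assms(1) pos by (intro card_mono) auto
  moreover have "?g \<in> V \<rightarrow>\<^sub>E {-1, 1}"
    using f by (auto simp: raise_def PiE_iff)
  ultimately have "?g \<in> majority_functions V E'"
    using assms(2) by (auto simp: majority_functions_def)
  then have "domination V E' \<le> sum ?g V"
    unfolding domination_def using assms(1)
    by (intro Min_le) (simp_all add: finite_majority_functions)
  \<comment> \<open>Opinions are at least -1, so raising one to 1 costs at most 2.\<close>
  also have "sum ?g V \<le> (\<Sum>w\<in>V. f w + (if w \<in> S then 2 else 0))"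
    using f by (intro sum_mono) (force simp: raise_def dest: PiE_mem)
  also have "\<dots> = sum f V + 2 * int (card S)"
    using assms(1,3) by (simp add: sum.distrib sum.If_cases Int_absorb1)
  finally show ?thesis .
qed

section \<open>Adding or deleting one edge\<close>

lemma domination_add_edge:
  assumes "finite V" "u \<in> V" "v \<in> V" "u \<noteq> v" "{u, v} \<notin> E"
  shows "domination V (insert {u, v} E) \<le> domination V E + 2"
proof -
  obtain f where f: "f \<in> majority_functions V E" "domination V E = sum f V"
    using domination_attained[of V E] assms(1,2) by blast
  then have fV: "f \<in> V \<rightarrow>\<^sub>E {-1, 1}"
    by (simp add: majority_functions_def)
  \<comment> \<open>If \<open>f u\<close> is already 1, \<open>v\<close> is raised instead; in both
    cases \<open>u\<close> ends with opinion 1.\<close>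
  define S where "S = (if f u = -1 then {u} else {v})"
  let ?g = "raise V S f"
  have gu: "?g u = 1"
    using fV assms(2) by (force simp: S_def raise_def dest: PiE_mem)
  have "domination V (insert {u, v} E) \<le> sum f V + 2 * int (card S)"
  proof (rule domination_le_raise[OF assms(1) f(1)])
    show "S \<subseteq> V"
      using assms by (simp add: S_def)
  next
    fix x
    assume x: "x \<in> V" and pos: "sum f (nbhd V E x) > 0"
    have ge: "sum f (nbhd V E x) \<le> sum ?g (nbhd V E x)"
      by (rule sum_raise_ge[OF fV])
    consider "x = u" | "x = v" | "x \<notin> {u, v}"
      by blast
    then show "sum ?g (nbhd V (insert {u, v} E) x) > 0"
    proof cases
      case 1
      \<comment> \<open>The new neighbor of \<open>u\<close> is \<open>v\<close>. If
        \<open>u\<close> was raised, its loop gains 2, which outweighs a loss of 1 from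
        \<open>v\<close>; otherwise \<open>v\<close> itself has opinion 1.\<close>
      have "?g v + sum ?g (nbhd V E u) > 0"
      proof (cases "f u = -1")
        case True
        have "sum f (nbhd V E u) + 2 \<le> sum ?g (nbhd V E u)"
          using True assms by (intro sum_raise_gain[OF _ fV, of u]) (simp_all add: S_def self_in_nbhd)
        moreover have "?g v \<ge> -1"
          using raise_ge[OF fV assms(3), of S] PiE_mem[OF fV assms(3)] by auto
        ultimately show ?thesis
          using pos 1 by simp
      next
        case False
        then have "?g v = 1"
          using assms(3) by (simp add: S_def raise_in)
        then show ?thesis
          using ge pos 1 by simp
      qed
      then show ?thesis
        using sum_nbhd_insert[OF assms(1,3,4,5), of ?g] 1 by simp
    next
      case 2
      \<comment> \<open>The new neighbor of \<open>v\<close> is \<open>u\<close>, which contributes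
        1.\<close>
      have "sum ?g (nbhd V (insert {u, v} E) v) = ?g u + sum ?g (nbhd V E v)"
        using sum_nbhd_insert[of V u v E ?g] assms by (simp add: insert_commute)
      then show ?thesis
        using gu ge pos 2 by simp
    next
      case 3
      then show ?thesis
        using ge pos by (simp add: nbhd_insert_other)
    qed
  qed
  then show ?thesis
    using f(2) by (simp add: S_def split: if_splits)
qed

text \<open>Here \<open>E\<close> is the edge set after the deletion and
  \<open>insert {u, v} E\<close> the one before it.\<close>

lemma domination_delete_edge:
  assumes "finite V" "u \<in> V" "v \<in> V" "u \<noteq> v" "{u, v} \<notin> E"
  shows "domination V E \<le> domination V (insert {u, v} E) + 4"
proof -
  obtain f where f: "f \<in> majority_functions V (insert {u, v} E)"
    "domination V (insert {u, v} E) = sum f V"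
    using domination_attained[of V "insert {u, v} E"] assms(1,2) by blast
  then have fV: "f \<in> V \<rightarrow>\<^sub>E {-1, 1}"
    by (simp add: majority_functions_def)
  \<comment> \<open>\<open>r x\<close> will be a neighbor of \<open>x\<close> with opinion -1 if
    there is one, and an arbitrary neighbor otherwise; \<open>x\<close> itself serves in that second
    case.\<close>
  have "\<exists>w \<in> nbhd V E x. (\<exists>y \<in> nbhd V E x. f y = -1) \<longrightarrow> f w = -1" if "x \<in> V" for x
    using self_in_nbhd[OF that] by blast
  then obtain r where r: "\<And>x. x \<in> V \<Longrightarrow> r x \<in> nbhd V E x"
    "\<And>x y. x \<in> V \<Longrightarrow> y \<in> nbhd V E x \<Longrightarrow> f y = -1 \<Longrightarrow> f (r x) = -1"
    by metis
  define S where "S = {r u, r v}"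
  let ?g = "raise V S f"
  \<comment> \<open>A sum of 0 is allowed: either \<open>r x\<close> has opinion -1 and raising it
    gains 2, or all opinions around \<open>x\<close> are 1 and the loop makes the sum
    positive.\<close>
  have restore: "sum ?g (nbhd V E x) > 0"
    if "x \<in> V" "r x \<in> S" "sum f (nbhd V E x) \<ge> 0" for x
  proof (cases "f (r x) = -1")
    case True
    then show ?thesis
      using sum_raise_gain[OF assms(1) fV r(1)] that by fastforce
  next
    case False
    have "f y = 1" if "y \<in> nbhd V E x" for y
    proof -
      have "f y \<noteq> -1"
        using r(2)[OF \<open>x \<in> V\<close> that] False by blast
      then show ?thesis
        using PiE_mem[OF fV, of y] that by (auto simp: nbhd_def)
    qed
    then have "sum f (nbhd V E x) > 0"
      using self_in_nbhd[OF \<open>x \<in> V\<close>, of E] finite_nbhd[OF assms(1)] by (intro sum_pos) auto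
    then show ?thesis
      using sum_raise_ge[OF fV, of E x S] by linarith
  qed
  have "domination V E \<le> sum f V + 2 * int (card S)"
  proof (rule domination_le_raise[OF assms(1) f(1)])
    show "S \<subseteq> V"
      using r(1)[OF assms(2)] r(1)[OF assms(3)] by (auto simp: S_def nbhd_def)
  next
    fix x
    assume x: "x \<in> V" and pos: "sum f (nbhd V (insert {u, v} E) x) > 0"
    \<comment> \<open>Losing a neighbor of opinion at most 1 takes a positive integer sum to at
      least 0, which is what \<open>restore\<close> asks for.\<close>
    have le1: "f u \<le> 1" "f v \<le> 1"
      using PiE_mem[OF fV] assms(2,3) by fastforce+
    consider "x = u" | "x = v" | "x \<notin> {u, v}"
      by blast
    then show "sum ?g (nbhd V E x) > 0"
    proof cases
      case 1
      then show ?thesis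
        using pos le1 x sum_nbhd_insert[OF assms(1,3,4,5), of f]
        by (intro restore) (auto simp: S_def)
    next
      case 2
      have "sum f (nbhd V (insert {u, v} E) v) = f u + sum f (nbhd V E v)"
        using sum_nbhd_insert[of V u v E f] assms by (simp add: insert_commute)
      then show ?thesis
        using pos le1 x 2 by (intro restore) (auto simp: S_def)
    next
      case 3
      then show ?thesis
        using pos sum_raise_ge[OF fV, of E x S] by (simp add: nbhd_insert_other)
    qed
  qed
  \<comment> \<open>\<open>r u\<close> and \<open>r v\<close> may coincide, hence only an
    inequality.\<close>
  moreover have "card S \<le> 2"
    using card_insert_le_m1[of 2 "{r v}" "r u"] by (simp add: S_def)
  ultimately show ?thesis
    using f(2) by simp
qed

section \<open>Several edges\<close>

text \<open>Inserting the edges of \<open>A\<close> one at a time gives the first bound; reading the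
  same steps backwards as deletions gives the second.\<close>

lemma domination_Un_edges:
  assumes "finite V" "finite A" "A \<inter> E = {}"
    and "\<And>e. e \<in> A \<Longrightarrow> \<exists>u v. e = {u, v} \<and> u \<noteq> v \<and> u \<in> V \<and> v \<in> V"
  shows "domination V (E \<union> A) \<le> domination V E + 2 * int (card A) \<and>
    domination V E \<le> domination V (E \<union> A) + 4 * int (card A)"
  using assms(2-)
proof (induction A)
  case empty
  then show ?case
    by simp
next
  case (insert e A)
  obtain u v where e: "e = {u, v}" and uv: "u \<in> V" "v \<in> V" "u \<noteq> v"
    using insert.prems(2)[of e] by blast
  have new: "{u, v} \<notin> E \<union> A"
    using insert.hyps(2) insert.prems(1) e by blast
  have IH: "domination V (E \<union> A) \<le> domination V E + 2 * int (card A) \<and>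
    domination V E \<le> domination V (E \<union> A) + 4 * int (card A)"
    using insert.prems by (intro insert.IH) auto
  show ?case
    using IH domination_add_edge[OF assms(1) uv new] domination_delete_edge[OF assms(1) uv new]
      insert.hyps by (simp add: e)
qed

theorem theorem3:
  fixes G H :: "'a pair_pre_digraph" and l m :: nat
  assumes "looped_graph G" and "looped_graph H" and "pverts G \<noteq> {}"
    and "edge_edit l m G H"
  shows "- 4 * int l - 2 * int m \<le> strict_domination_number G - strict_domination_number H
    \<and> strict_domination_number G - strict_domination_number H \<le> 2 * int l + 4 * int m"
proof -
  interpret G: looped_graph G by fact
  interpret H: looped_graph H by fact
  obtain D A where V: "pverts H = pverts G"
    and D: "D \<subseteq> nonloop_edges G" "card D = l"
    and A: "A \<inter> (nonloop_edges G - D) = {}" "card A = m"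
    and H_edges: "nonloop_edges H = (nonloop_edges G - D) \<union> A"
    using assms(4) by (auto simp: edge_edit_def)
  \<comment> \<open>\<open>?K\<close> is the graph between the two stages: adding \<open>D\<close>
    to it gives \<open>G\<close>, adding \<open>A\<close> gives \<open>H\<close>. The comparisons of
    \<open>?K\<close> with \<open>G\<close> and with \<open>H\<close> then add up to both
    bounds.\<close>
  let ?V = "pverts G" and ?K = "nonloop_edges G - D"
  have "finite D"
    using D(1) G.finite_nonloop_edges by (rule finite_subset)
  moreover have "\<exists>u v. e = {u, v} \<and> u \<noteq> v \<and> u \<in> ?V \<and> v \<in> ?V" if "e \<in> D" for e
    using that D(1) by (blast elim: G.nonloop_edges_obtain)
  moreover have "?K \<union> D = nonloop_edges G"
    using D(1) by blast
  ultimately have "domination ?V (nonloop_edges G) \<le> domination ?V ?K + 2 * int l"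
    "domination ?V ?K \<le> domination ?V (nonloop_edges G) + 4 * int l"
    using domination_Un_edges[of ?V D ?K] D(2) by auto
  \<comment> \<open>An infinite set has \<open>card\<close> 0, so \<open>card A = m\<close> alone
    does not bound \<open>A\<close>; finiteness comes from the edges of \<open>H\<close>.\<close>
  moreover have "finite A"
    using H_edges H.finite_nonloop_edges by simp
  moreover have "\<exists>u v. e = {u, v} \<and> u \<noteq> v \<and> u \<in> ?V \<and> v \<in> ?V" if "e \<in> A" for e
  proof -
    have "e \<in> nonloop_edges H"
      using that H_edges by simp
    then show ?thesis
      using V by (metis H.nonloop_edges_obtain)
  qed
  ultimately show ?thesis
    using domination_Un_edges[of ?V A ?K] A
    by (simp add: G.strict_domination_number_eq H.strict_domination_number_eq V H_edges)
qed

end
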